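(* Let $S=[0,1]$. Let $\{\mathcal{Z}_i:i\ge 1\}$ be i.i.d. $M_1(S)$-valued random probability measures with common law $\Pi$, and, independently of them, let ${\bf W}=\{(W_{n1},\dots,W_{nn}):n\ge 1\}$ be a triangular array of positive random variables. Put $X_{ni}=W_{ni}/\sum_{k=1}^n W_{nk}$ for $1\le i\le n$, assume that $\lim_{n\to\infty}\mathbb{E}\big[\sum_{i=1}^n X_{ni}^2\big]=0$, and let $\Pi_n$ denote the law on $M_1(S)$ of $$\mathcal{W}_n(\Pi;{\bf W})=\sum_{i=1}^n X_{ni}\mathcal{Z}_i .$$ Assume that for every $\mu\in M_1(S)$, every $m\ge 1$, and all $0<t_1<\dots<t_m<1$ in $S_\mu$, there exists $I_{t_1,\dots,t_m}(\mu)\in[0,\infty]$ such that $$\lim_{\delta\to 0}\liminf_{n\to\infty}\frac1n\log \Pi_n\{B_{t_1,\dots,t_m}(\mu,\delta)\}=\lim_{\delta\to 0}\limsup_{n\to\infty}\frac1n\log \Pi_n\{\overline{B}_{t_1,\dots,t_m}(\mu,\delta)\}=-I_{t_1,\dots,t_m}(\mu).$$ Then the sequence $\{\Pi_n:n\ge 1\}$ satisfies a large deviation principle on $M_1(S)$ (with speed $n$) with good rate function $$I(\mu)=\sup\{I_{t_1,\dots,t_m}(\mu): m\ge 1,\ 0<t_1<\dots<t_m<1,\ t_1,\dots,t_m\in S_\mu\}.$$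
   Context: $M_1(S)$ is the space of Borel probability measures on $S=[0,1]$ with the weak topology. For $\mu\in M_1(S)$, $S_\mu=\{t\in S: t \text{ is a continuity point of }\mu\}$, i.e. $\mu(\{t\})=0$. For $0=t_0<t_1<\dots<t_m<1$ with $t_1,\dots,t_m\in S_\mu$ and $\upsilon\in M_1(S)$, $$\rho_{t_1,\dots,t_m}(\upsilon,\mu)=|\upsilon([t_m,1])-\mu([t_m,1])|+\sum_{i=1}^m|\upsilon([t_{i-1},t_i))-\mu([t_{i-1},t_i))|,$$ $$B_{t_1,\dots,t_m}(\mu,\delta)=\{\upsilon\in M_1(S):\rho_{t_1,\dots,t_m}(\upsilon,\mu)<\delta\},\quad \overline{B}_{t_1,\dots,t_m}(\mu,\delta)=\{\upsilon\in M_1(S):\rho_{t_1,\dots,t_m}(\upsilon,\mu)\le\delta\}.$$ Large deviation principle with speed $n$ and rate function $I$: $\limsup_n \frac1n\log\Pi_n(C)\le-\inf_C I$ for closed $C$ and $\liminf_n\frac1n\log\Pi_n(G)\ge-\inf_G I$ for open $G$; the rate function is good if its sublevel sets $\{I\le c\}$, $c<\infty$, are compact. Convention: $\log 0=-\infty$. *)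

theory Defs
  imports "HOL-Probability.Probability"
begin

abbreviation unit_borel :: "real measure" where
  "unit_borel \<equiv> restrict_space borel {0..1}"

definition M1 :: "real measure set" where
  "M1 = space (prob_algebra unit_borel)"

text \<open>The initial topology of the maps \<open>\<nu> \<mapsto> \<integral> f d\<nu>\<close>; continuous functions on \<open>[0,1]\<close> are
  automatically bounded. With \<open>U = UNIV\<close> one sees that the underlying space is all of \<^const>\<open>M1\<close>.\<close>

definition weak_topology :: "real measure topology" where
  "weak_topology = topology_generated_by
     {{\<nu> \<in> M1. (\<integral>x. f x \<partial>\<nu>) \<in> U} | (f :: real \<Rightarrow> real) (U :: real set).
        continuous_on {0..1} f \<and> open U}"

definition borel_of :: "'a topology \<Rightarrow> 'a measure" where
  "borel_of T = sigma (topspace T) {U. openin T U}"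

abbreviation borel_M1 :: "real measure measure" where
  "borel_M1 \<equiv> borel_of weak_topology"

definition continuity_points :: "real measure \<Rightarrow> real set" where
  "continuity_points \<mu> = {t \<in> {0..1}. measure \<mu> {t} = 0}"

text \<open>A partition \<open>0 < t\<^sub>1 < \<dots> < t\<^sub>m < 1\<close> is the list \<open>[t\<^sub>1, \<dots>, t\<^sub>m]\<close>, with \<open>m \<ge> 1\<close>;
  the point \<open>t\<^sub>0 = 0\<close> is not stored.\<close>

definition partitions :: "real measure \<Rightarrow> real list set" where
  "partitions \<mu> = {ts. ts \<noteq> [] \<and> sorted_wrt (<) ts \<and> set ts \<subseteq> {0<..<1} \<inter> continuity_points \<mu>}"

definition rho :: "real list \<Rightarrow> real measure \<Rightarrow> real measure \<Rightarrow> real" where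
  "rho ts \<nu> \<mu> = \<bar>measure \<nu> {last ts..1} - measure \<mu> {last ts..1}\<bar>
     + (\<Sum>i<length ts. \<bar>measure \<nu> {(0 # ts) ! i..<ts ! i} - measure \<mu> {(0 # ts) ! i..<ts ! i}\<bar>)"

definition rho_ball :: "real list \<Rightarrow> real measure \<Rightarrow> real \<Rightarrow> real measure set" where
  "rho_ball ts \<mu> \<delta> = {\<nu> \<in> M1. rho ts \<nu> \<mu> < \<delta>}"

definition rho_cball :: "real list \<Rightarrow> real measure \<Rightarrow> real \<Rightarrow> real measure set" where
  "rho_cball ts \<mu> \<delta> = {\<nu> \<in> M1. rho ts \<nu> \<mu> \<le> \<delta>}"

definition elog :: "real \<Rightarrow> ereal" where
  "elog p = (if p = 0 then -\<infinity> else ereal (ln p))"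

definition rate_function :: "'a topology \<Rightarrow> ('a \<Rightarrow> ereal) \<Rightarrow> bool" where
  "rate_function T I \<longleftrightarrow> (\<forall>x\<in>topspace T. 0 \<le> I x) \<and>
     (\<forall>c::real. closedin T {x \<in> topspace T. I x \<le> ereal c})"

definition good_rate_function :: "'a topology \<Rightarrow> ('a \<Rightarrow> ereal) \<Rightarrow> bool" where
  "good_rate_function T I \<longleftrightarrow> rate_function T I \<and>
     (\<forall>c::real. compactin T {x \<in> topspace T. I x \<le> ereal c})"

text \<open>Large deviation principle with speed \<open>n\<close>. An infimum over the empty set is \<open>\<infinity>\<close>.\<close>

definition satisfies_ldp :: "'a topology \<Rightarrow> (nat \<Rightarrow> 'a measure) \<Rightarrow> ('a \<Rightarrow> ereal) \<Rightarrow> bool" where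
  "satisfies_ldp T P I \<longleftrightarrow>
     (\<forall>C. closedin T C \<longrightarrow>
        limsup (\<lambda>n. ereal (1 / real n) * elog (measure (P n) C)) \<le> - (INF x\<in>C. I x)) \<and>
     (\<forall>G. openin T G \<longrightarrow>
        liminf (\<lambda>n. ereal (1 / real n) * elog (measure (P n) G)) \<ge> - (INF x\<in>G. I x))"

text \<open>The library's \<open>indep_var\<close> requires both random variables to have the same value type.\<close>

definition indep_rvs ::
  "'a measure \<Rightarrow> 'b measure \<Rightarrow> ('a \<Rightarrow> 'b) \<Rightarrow> 'c measure \<Rightarrow> ('a \<Rightarrow> 'c) \<Rightarrow> bool" where
  "indep_rvs M N X L Y \<longleftrightarrow> X \<in> measurable M N \<and> Y \<in> measurable M L \<and>
     prob_space.indep_set M {X -` A \<inter> space M | A. A \<in> sets N} {Y -` B \<inter> space M | B. B \<in> sets L}"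

definition array_indices :: "(nat \<times> nat) set" where
  "array_indices = {(n, i). 1 \<le> i \<and> i \<le> n}"

definition normalized :: "(nat \<Rightarrow> nat \<Rightarrow> 'a \<Rightarrow> real) \<Rightarrow> nat \<Rightarrow> nat \<Rightarrow> 'a \<Rightarrow> real" where
  "normalized W n i \<omega> = W n i \<omega> / (\<Sum>k=1..n. W n k \<omega>)"

definition mixture :: "nat \<Rightarrow> (nat \<Rightarrow> real) \<Rightarrow> (nat \<Rightarrow> real measure) \<Rightarrow> real measure" where
  "mixture n x \<zeta> = measure_of {0..1} (sets unit_borel)
     (\<lambda>A. \<Sum>i=1..n. ennreal (x i) * emeasure (\<zeta> i) A)"

definition weighted_law ::
  "'a measure \<Rightarrow> (nat \<Rightarrow> 'a \<Rightarrow> real measure) \<Rightarrow> (nat \<Rightarrow> nat \<Rightarrow> 'a \<Rightarrow> real) \<Rightarrow> nat \<Rightarrow> real measure measure"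
where
  "weighted_law M Z W n =
     distr M borel_M1 (\<lambda>\<omega>. mixture n (\<lambda>i. normalized W n i \<omega>) (\<lambda>i. Z i \<omega>))"

end

theory Submission
  imports Defs
begin

text \<open>On a compact space a sequence of laws satisfies an LDP with rate \<open>I\<close> as soon as every open
  neighbourhood of each \<open>x\<close> has lower exponential rate at least \<open>- I x\<close>, and neighbourhoods of \<open>x\<close>
  exist whose upper rate is arbitrarily close to \<open>- I x\<close>: a finite cover gives the upper bound, and
  comparing the two rates of one neighbourhood gives lower semicontinuity of \<open>I\<close>. The space
  \<^const>\<open>M1\<close> is compact, because by Weierstrass approximation its topology is pulled back along the
  moment map, whose image is compact by Helly's theorem. The sets \<open>rho_ball ts \<mu> \<delta>\<close>, although not
  weakly open, are interchangeable with weak neighbourhoods of \<open>\<mu>\<close>: they contain one since the points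
  of \<open>ts\<close> are not atoms of \<open>\<mu>\<close>, and conversely a continuous function is uniformly close to a step
  function over any sufficiently fine partition.\<close>

subsection \<open>Large deviations on compact spaces\<close>

lemma space_borel_of: "space (borel_of T) = topspace T"
  unfolding borel_of_def by (rule space_measure_of) (auto dest: openin_subset)

lemma openin_imp_sets_borel_of: "openin T U \<Longrightarrow> U \<in> sets (borel_of T)"
  unfolding borel_of_def by (auto dest: openin_subset)

lemma elog_mono: "0 \<le> p \<Longrightarrow> p \<le> q \<Longrightarrow> elog p \<le> elog q"
  by (auto simp: elog_def)

lemma scaled_elog_mono: "0 \<le> p \<Longrightarrow> p \<le> q \<Longrightarrow> ereal (1 / real n) * elog p \<le> ereal (1 / real n) * elog q"
  by (intro ereal_mult_left_mono elog_mono) auto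

text \<open>Translates a rate bound into a bound on probabilities, where a union bound can be
  applied, and back again. The index \<open>n = 0\<close> is excluded because
  \<open>1 / real 0 = 0\<close> makes the left side independent of \<open>p\<close>.\<close>

lemma scaled_elog_le_iff:
  assumes "n > 0" "0 \<le> p"
  shows "ereal (1 / real n) * elog p \<le> ereal b \<longleftrightarrow> p \<le> exp (b * real n)"
proof (cases "p = 0")
  case True
  then show ?thesis using assms by (simp add: elog_def)
next
  case False
  then have "ln p \<le> b * real n \<longleftrightarrow> p \<le> exp (b * real n)"
    using assms by (metis exp_le_cancel_iff exp_ln order_le_less)
  then show ?thesis
    using False assms by (simp add: elog_def divide_le_eq)
qed

text \<open>Measurability is asked of \<open>B\<close> alone: \<open>measure\<close> is 0 by default
  outside the sigma-algebra, so the inequality persists for arbitrary \<open>A\<close>.\<close>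

lemma (in finite_measure) scaled_elog_measure_mono:
  "A \<subseteq> B \<Longrightarrow> B \<in> sets M \<Longrightarrow>
    ereal (1 / real n) * elog (measure M A) \<le> ereal (1 / real n) * elog (measure M B)"
  by (intro scaled_elog_mono finite_measure_mono) auto

text \<open>Quantifying \<open>upper\<close> over reals \<open>a\<close> below \<open>I x\<close>
  treats finite and infinite values of \<open>I x\<close> alike. The argument rests on monotonicity
  and finite subadditivity, so the \<open>P n\<close> are merely finite measures.\<close>

theorem ldp_of_local_bounds:
  fixes P :: "nat \<Rightarrow> 'a measure"
  assumes compact: "compact_space T"
    and fin: "\<And>n. finite_measure (P n)"
    and sets: "\<And>n. sets (P n) = sets (borel_of T)"
    and nonneg: "\<And>x. x \<in> topspace T \<Longrightarrow> 0 \<le> I x"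
    and lower: "\<And>G x. openin T G \<Longrightarrow> x \<in> G \<Longrightarrow>
      - I x \<le> liminf (\<lambda>n. ereal (1 / real n) * elog (measure (P n) G))"
    and upper: "\<And>x a. x \<in> topspace T \<Longrightarrow> ereal a < I x \<Longrightarrow>
      \<exists>G. openin T G \<and> x \<in> G \<and>
        limsup (\<lambda>n. ereal (1 / real n) * elog (measure (P n) G)) < - ereal a"
  shows "good_rate_function T I \<and> satisfies_ldp T P I"
proof -
  have closed: "closedin T {x \<in> topspace T. I x \<le> ereal c}" for c
  proof -
    have "openin T {x \<in> topspace T. ereal c < I x}"
    proof (subst openin_subopen, safe)
      fix x assume x: "x \<in> topspace T" "ereal c < I x"
      from upper[OF this] obtain G where G: "openin T G" "x \<in> G"
        and ls: "limsup (\<lambda>n. ereal (1 / real n) * elog (measure (P n) G)) < - ereal c"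
        by blast
      \<comment> \<open>\<open>G\<close> is a neighbourhood of each of its points \<open>y\<close>,
        so its lower rate is at least \<open>- I y\<close>, whereas its upper rate is below
        \<open>- c\<close>.\<close>
      have "ereal c < I y" if "y \<in> G" for y
      proof -
        have "- I y \<le> limsup (\<lambda>n. ereal (1 / real n) * elog (measure (P n) G))"
          by (rule order_trans[OF lower[OF G(1) that] Liminf_le_Limsup]) simp
        then have "- I y < - ereal c" using ls by simp
        then show ?thesis by (simp only: ereal_minus_less_minus)
      qed
      then show "\<exists>G. openin T G \<and> x \<in> G \<and> G \<subseteq> {x \<in> topspace T. ereal c < I x}"
        using G openin_subset by blast
    qed
    moreover have "{x \<in> topspace T. I x \<le> ereal c} = topspace T - {x \<in> topspace T. ereal c < I x}"
      by auto
    ultimately show ?thesis by (simp add: closedin_diff)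
  qed
  have "limsup (\<lambda>n. ereal (1 / real n) * elog (measure (P n) C)) \<le> - (INF x\<in>C. I x)"
    if C: "closedin T C" for C
  proof -
    have bound: "limsup (\<lambda>n. ereal (1 / real n) * elog (measure (P n) C)) \<le> - ereal a"
      if a: "ereal a < (INF x\<in>C. I x)" for a
    proof -
      have "\<exists>G. openin T G \<and> x \<in> G \<and>
          limsup (\<lambda>n. ereal (1 / real n) * elog (measure (P n) G)) < - ereal a" if "x \<in> C" for x
        using that C a by (intro upper) (auto dest: closedin_subset intro: less_INF_D)
      then obtain G where G: "\<And>x. x \<in> C \<Longrightarrow> openin T (G x)" "\<And>x. x \<in> C \<Longrightarrow> x \<in> G x"
        and ls: "\<And>x. x \<in> C \<Longrightarrow>
          limsup (\<lambda>n. ereal (1 / real n) * elog (measure (P n) (G x))) < - ereal a"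
        by metis
      have "compactin T C" using C compact by (rule closedin_compact_space[rotated])
      then have "\<exists>\<F>. finite \<F> \<and> \<F> \<subseteq> G ` C \<and> C \<subseteq> \<Union>\<F>"
        using G by (intro compactinD[of T C "G ` C"]) auto
      then obtain F where F: "finite F" "F \<subseteq> C" "C \<subseteq> (\<Union>x\<in>F. G x)"
        by (metis finite_subset_image)
      have "\<forall>\<^sub>F n in sequentially. \<forall>x\<in>F.
          ereal (1 / real n) * elog (measure (P n) (G x)) < - ereal a"
        using F ls by (intro eventually_ball_finite ballI Limsup_lessD) auto
      \<comment> \<open>The number of covering sets is enlarged by one so that it stays positive, as
        \<open>exp (ln _)\<close> requires, even if \<open>F\<close> is empty. Its logarithm divided
        by \<open>n\<close> tends to 0.\<close>
      then have ev: "\<forall>\<^sub>F n in sequentially. ereal (1 / real n) * elog (measure (P n) C)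
          \<le> ereal (ln (real (Suc (card F))) / real n - a)"
        using eventually_gt_at_top[of 0]
      proof eventually_elim
        case (elim n)
        interpret finite_measure "P n" by (rule fin)
        have le: "measure (P n) (G x) \<le> exp (- a * real n)" if "x \<in> F" for x
          using elim that by (subst scaled_elog_le_iff[symmetric]) (auto intro: less_imp_le)
        have "measure (P n) C \<le> measure (P n) (\<Union>x\<in>F. G x)"
          using F G by (intro finite_measure_mono sets.finite_UN)
            (auto simp: sets intro!: openin_imp_sets_borel_of)
        also have "\<dots> \<le> (\<Sum>x\<in>F. measure (P n) (G x))"
          using F G by (intro finite_measure_subadditive_finite)
            (auto simp: sets intro!: openin_imp_sets_borel_of)
        also have "\<dots> \<le> (\<Sum>x\<in>F. exp (- a * real n))"
          by (intro sum_mono le)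
        also have "\<dots> \<le> real (Suc (card F)) * exp (- a * real n)"
          by simp
        also have "\<dots> = exp (ln (real (Suc (card F))) + - a * real n)"
          by (simp only: exp_add) simp
        also have "\<dots> = exp ((ln (real (Suc (card F))) / real n - a) * real n)"
          using elim by (simp add: left_diff_distrib)
        finally show ?case
          using elim by (subst scaled_elog_le_iff) auto
      qed
      have "(\<lambda>n. ln (real (Suc (card F))) / real n - a) \<longlonglongrightarrow> 0 - a"
        by (intro tendsto_diff lim_const_over_n tendsto_const)
      then have "limsup (\<lambda>n. ereal (ln (real (Suc (card F))) / real n - a)) = ereal (- a)"
        by (intro lim_imp_Limsup) auto
      then show ?thesis using Limsup_mono[OF ev] by simp
    qed
    \<comment> \<open>The infimum may be infinite, so it is approached by reals strictly below it,
      to which \<open>bound\<close> applies.\<close>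
    have "(INF x\<in>C. I x) \<le> - limsup (\<lambda>n. ereal (1 / real n) * elog (measure (P n) C))"
    proof (rule dense_le)
      fix y assume y: "y < (INF x\<in>C. I x)"
      show "y \<le> - limsup (\<lambda>n. ereal (1 / real n) * elog (measure (P n) C))"
      proof (cases y)
        case (real r)
        then show ?thesis
          using bound[of r] y by (metis ereal_uminus_le_reorder ereal_uminus_uminus)
      qed (use y in auto)
    qed
    then show ?thesis by (metis ereal_uminus_le_reorder ereal_uminus_uminus)
  qed
  moreover have "liminf (\<lambda>n. ereal (1 / real n) * elog (measure (P n) G)) \<ge> - (INF x\<in>G. I x)"
    if "openin T G" for G
  proof -
    have "- liminf (\<lambda>n. ereal (1 / real n) * elog (measure (P n) G)) \<le> (INF x\<in>G. I x)"
      using lower[OF that] by (intro INF_greatest) (metis ereal_uminus_le_reorder)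
    then show ?thesis by (metis ereal_uminus_le_reorder)
  qed
  ultimately show ?thesis
    using nonneg closed closedin_compact_space[OF compact]
    by (auto simp: good_rate_function_def rate_function_def satisfies_ldp_def)
qed

subsection \<open>Compactness of the space of probability measures\<close>

lemma M1_D:
  assumes "\<nu> \<in> M1"
  shows "prob_space \<nu>" "sets \<nu> = sets unit_borel" "space \<nu> = {0..1}"
proof -
  show "prob_space \<nu>" and s: "sets \<nu> = sets unit_borel"
    using assms by (auto simp: M1_def space_prob_algebra)
  show "space \<nu> = {0..1}"
    using sets_eq_imp_space_eq[OF s] by (simp add: space_restrict_space)
qed

lemma M1_sets_iff: "\<nu> \<in> M1 \<Longrightarrow> A \<in> sets \<nu> \<longleftrightarrow> A \<in> sets borel \<and> A \<subseteq> {0..1}"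
  by (auto simp: M1_D sets_restrict_space_iff)

lemma M1_integrable_continuous:
  fixes f :: "real \<Rightarrow> real"
  assumes \<nu>: "\<nu> \<in> M1" and f: "continuous_on {0..1} f"
  shows "integrable \<nu> f"
proof -
  interpret prob_space \<nu> by (rule M1_D[OF \<nu>])
  obtain B where B: "\<And>x. x \<in> {0..1} \<Longrightarrow> norm (f x) \<le> B"
    using compact_imp_bounded[OF compact_continuous_image[OF f compact_Icc]]
    unfolding bounded_iff by blast
  show ?thesis
  proof (rule integrable_const_bound)
    show "AE x in \<nu>. norm (f x) \<le> B"
      using B by (auto simp: M1_D[OF \<nu>])
    show "f \<in> borel_measurable \<nu>"
      using borel_measurable_continuous_on_restrict[OF f] M1_D(2)[OF \<nu>]
      by (simp cong: measurable_cong_sets)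
  qed
qed

lemma M1_integral_le:
  fixes f g :: "real \<Rightarrow> real"
  assumes "\<nu> \<in> M1" "integrable \<nu> f" "integrable \<nu> g" "\<And>x. x \<in> {0..1} \<Longrightarrow> f x \<le> g x"
  shows "integral\<^sup>L \<nu> f \<le> integral\<^sup>L \<nu> g"
  using assms by (intro integral_mono) (auto simp: M1_D)

lemma M1_integral_dist_le:
  fixes f g :: "real \<Rightarrow> real"
  assumes \<nu>: "\<nu> \<in> M1" and int: "integrable \<nu> f" "integrable \<nu> g"
    and le: "\<And>x. x \<in> {0..1} \<Longrightarrow> \<bar>f x - g x\<bar> \<le> e"
  shows "\<bar>integral\<^sup>L \<nu> f - integral\<^sup>L \<nu> g\<bar> \<le> e"
proof -
  interpret prob_space \<nu> by (rule M1_D[OF \<nu>])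
  have "integral\<^sup>L \<nu> f \<le> integral\<^sup>L \<nu> (\<lambda>x. g x + e)" "integral\<^sup>L \<nu> g \<le> integral\<^sup>L \<nu> (\<lambda>x. f x + e)"
    using \<nu> int le by (intro M1_integral_le; force simp: abs_le_iff dest!: le)+
  then show ?thesis using int by (simp add: prob_space)
qed

lemma openin_weak_topology_integral:
  fixes f :: "real \<Rightarrow> real"
  shows "continuous_on {0..1} f \<Longrightarrow> open U \<Longrightarrow> openin weak_topology {\<nu> \<in> M1. (\<integral>x. f x \<partial>\<nu>) \<in> U}"
  unfolding weak_topology_def by (rule topology_generated_by_Basis) blast

lemma topspace_weak_topology: "topspace weak_topology = M1"
proof
  show "topspace weak_topology \<subseteq> M1"
    unfolding weak_topology_def topology_generated_by_topspace by (rule Union_least) force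
  have "openin weak_topology {\<nu> \<in> M1. (\<integral>x. (0::real) \<partial>\<nu>) \<in> UNIV}"
    by (intro openin_weak_topology_integral) auto
  then show "M1 \<subseteq> topspace weak_topology"
    using openin_subset by fastforce
qed

section \<open>Moment sequences and the compactness of their range\<close>

definition moments :: "real measure \<Rightarrow> nat \<Rightarrow> real" where
  "moments \<nu> k = (\<integral>x. x ^ k \<partial>\<nu>)"

text \<open>Induction over the generation of open sets leaves only subbasic sets to analyse. There a
  polynomial uniformly close to \<open>f\<close> on the unit interval replaces \<open>f\<close> at a
  cost that is the same for all measures, and the integral of a polynomial depends on finitely many
  moments.\<close>

lemma weak_topology_moment_neighbourhood:
  assumes "openin weak_topology U" "\<nu> \<in> U"
  shows "\<exists>V. open V \<and> moments \<nu> \<in> V \<and> {\<nu>' \<in> M1. moments \<nu>' \<in> V} \<subseteq> U"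
proof -
  have "generate_topology_on {{\<nu> \<in> M1. (\<integral>x. f x \<partial>\<nu>) \<in> U} | (f :: real \<Rightarrow> real) (U :: real set).
        continuous_on {0..1} f \<and> open U} U"
    using assms(1) unfolding weak_topology_def by (rule openin_topology_generated_by)
  then show ?thesis using assms(2)
  proof (induction U)
    case Empty
    then show ?case by simp
  next
    case (Int a b)
    then obtain V V' where "open V \<and> moments \<nu> \<in> V \<and> {\<nu>' \<in> M1. moments \<nu>' \<in> V} \<subseteq> a"
      "open V' \<and> moments \<nu> \<in> V' \<and> {\<nu>' \<in> M1. moments \<nu>' \<in> V'} \<subseteq> b"
      by blast
    then show ?case by (intro exI[of _ "V \<inter> V'"]) auto
  next
    case (UN K)
    then show ?case by (meson UnionE Union_upper order_trans)
  next
    case (Basis s)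
    then obtain f :: "real \<Rightarrow> real" and U where s: "s = {\<nu> \<in> M1. (\<integral>x. f x \<partial>\<nu>) \<in> U}"
      and f: "continuous_on {0..1} f" and U: "open U" by blast
    with Basis have \<nu>: "\<nu> \<in> M1" "(\<integral>x. f x \<partial>\<nu>) \<in> U" by auto
    obtain e where e: "e > 0" "ball (\<integral>x. f x \<partial>\<nu>) e \<subseteq> U"
      using U \<nu>(2) open_contains_ball by blast
    obtain g where g: "real_polynomial_function g" "\<And>x. x \<in> {0..1} \<Longrightarrow> \<bar>f x - g x\<bar> < e / 3"
      using Stone_Weierstrass_real_polynomial_function[OF compact_Icc f, of "e / 3"] e by auto
    obtain a n where a: "g = (\<lambda>x. \<Sum>i\<le>n. a i * x ^ i)"
      using g(1) real_polynomial_function_iff_sum by blast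
    have cg: "continuous_on {0..1} g" unfolding a by (intro continuous_intros)
    have int_g: "integral\<^sup>L \<nu>' g = (\<Sum>i\<le>n. a i * moments \<nu>' i)" if "\<nu>' \<in> M1" for \<nu>'
      unfolding a moments_def
      by (subst Bochner_Integration.integral_sum)
        (auto intro!: M1_integrable_continuous[OF that] continuous_intros)
    have near: "\<bar>integral\<^sup>L \<nu>' f - integral\<^sup>L \<nu>' g\<bar> \<le> e / 3" if "\<nu>' \<in> M1" for \<nu>'
      using that g(2) by (intro M1_integral_dist_le M1_integrable_continuous f cg) (auto intro: less_imp_le)
    \<comment> \<open>Two approximation errors of at most \<open>e / 3\<close> leave a tolerance of
      \<open>e / 3\<close> for the polynomial integral. The condition involves finitely many
      coordinates continuously, so \<open>?V\<close> is open in the product topology.\<close>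
    let ?V = "{y. \<bar>(\<Sum>i\<le>n. a i * y i) - integral\<^sup>L \<nu> g\<bar> < e / 3}"
    have "open ?V"
      by (intro open_Collect_less continuous_intros continuous_on_product_coordinates)
    moreover have "moments \<nu> \<in> ?V" using int_g[OF \<nu>(1)] e by simp
    moreover have "{\<nu>' \<in> M1. moments \<nu>' \<in> ?V} \<subseteq> s"
    proof safe
      fix \<nu>' assume \<nu>': "\<nu>' \<in> M1" "\<bar>(\<Sum>i\<le>n. a i * moments \<nu>' i) - integral\<^sup>L \<nu> g\<bar> < e / 3"
      then have "integral\<^sup>L \<nu>' f \<in> ball (integral\<^sup>L \<nu> f) e"
        using near[OF \<nu>'(1)] near[OF \<nu>(1)]
        unfolding int_g[OF \<nu>'(1), symmetric] mem_ball dist_real_def by linarith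
      then show "\<nu>' \<in> s" using e \<nu>' by (auto simp: s)
    qed
    ultimately show ?case by blast
  qed
qed

text \<open>\<open>tight\<close> and \<open>weak_conv_m\<close> concern distributions on the whole
  line. Pushing forward along the inclusion moves a measure on \<open>{0..1}\<close> there and
  preserves integrals.\<close>

lemma M1_distr_borel:
  assumes \<nu>: "\<nu> \<in> M1"
  shows "real_distribution (distr \<nu> borel (\<lambda>x. x))"
    and "h \<in> borel_measurable borel \<Longrightarrow> (\<integral>x. h x \<partial>distr \<nu> borel (\<lambda>x. x)) = (\<integral>x. (h x :: real) \<partial>\<nu>)"
    and "A \<in> sets borel \<Longrightarrow> {0..1} \<subseteq> A \<Longrightarrow> measure (distr \<nu> borel (\<lambda>x. x)) A = 1"
proof -
  interpret prob_space \<nu> by (rule M1_D[OF \<nu>])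
  have id[measurable]: "(\<lambda>x. x) \<in> measurable \<nu> borel"
    using measurable_restrict_space1[OF measurable_id, of borel "{0..1}"] M1_D(2)[OF \<nu>]
    by (simp cong: measurable_cong_sets)
  show "real_distribution (distr \<nu> borel (\<lambda>x. x))" by simp
  show "(\<integral>x. h x \<partial>distr \<nu> borel (\<lambda>x. x)) = (\<integral>x. (h x :: real) \<partial>\<nu>)" if "h \<in> borel_measurable borel"
    using that by (subst integral_distr) auto
  show "measure (distr \<nu> borel (\<lambda>x. x)) A = 1" if "A \<in> sets borel" "{0..1} \<subseteq> A"
  proof -
    have "A \<inter> space \<nu> = space \<nu>" using that by (auto simp: M1_D[OF \<nu>])
    then show ?thesis using that prob_space by (simp add: measure_distr)
  qed
qed

text \<open>In a countable product of real lines, sequential compactness is compactness. Confinement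
  to the unit interval gives tightness, Helly selection gives a weakly convergent subsequence, and
  its limit is shown to live on the unit interval again.\<close>

lemma compact_moments: "compact (moments ` M1)"
  unfolding seq_compact_eq_compact[symmetric]
proof (rule seq_compactI)
  fix y :: "nat \<Rightarrow> nat \<Rightarrow> real" assume "\<forall>n. y n \<in> moments ` M1"
  then have "\<forall>n. \<exists>\<nu>. \<nu> \<in> M1 \<and> y n = moments \<nu>" by blast
  then obtain \<nu> where \<nu>: "\<And>n. \<nu> n \<in> M1" and y: "\<And>n. y n = moments (\<nu> n)"
    by metis
  define \<mu> where "\<mu> n = distr (\<nu> n) borel (\<lambda>x. x)" for n
  have \<mu>: "real_distribution (\<mu> n)" for n
    unfolding \<mu>_def by (rule M1_distr_borel[OF \<nu>])
  have "tight \<mu>"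
    unfolding tight_def
  proof (intro conjI allI impI \<mu>)
    fix e :: real assume "e > 0"
    have "measure (\<mu> n) {-1<..1} = 1" for n
      unfolding \<mu>_def by (rule M1_distr_borel(3)[OF \<nu>]) auto
    with \<open>e > 0\<close> have "(-1::real) < 1 \<and> (\<forall>n. 1 - e < measure (\<mu> n) {-1<..1})" by simp
    then show "\<exists>a b. a < b \<and> (\<forall>n. 1 - e < measure (\<mu> n) {a<..b})" by blast
  qed
  from tight_imp_convergent_subsubsequence[OF this strict_mono_id]
  obtain r N where r: "strict_mono r" and N: "real_distribution N" and conv: "weak_conv_m (\<mu> \<circ> r) N"
    by auto
  interpret N: real_distribution N by (rule N)
  have lim: "(\<lambda>n. integral\<^sup>L ((\<mu> \<circ> r) n) f) \<longlonglongrightarrow> integral\<^sup>L N f"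
    if "\<And>x. isCont f x" "\<And>x. norm (f x) \<le> B" for f :: "real \<Rightarrow> real" and B
    using \<mu> by (intro weak_conv_imp_integral_bdd_continuous_conv[OF _ N conv that]) auto
  \<comment> \<open>Nonconstant monomials are unbounded on the line; powers of \<open>clamp\<close>
    are bounded and agree with them on \<open>{0..1}\<close>. The bounded function \<open>g\<close>
    vanishes exactly on \<open>{0..1}\<close>: its integrals are 0 along the sequence, hence also in
    the limit, which forces \<open>N\<close> to be carried by \<open>{0..1}\<close>.\<close>
  define clamp where "clamp x = max 0 (min 1 x)" for x :: real
  define g where "g x = min 1 \<bar>x - clamp x\<bar>" for x :: real
  have cont: "continuous_on UNIV clamp" "continuous_on UNIV g"
    unfolding clamp_def g_def by (intro continuous_intros)+
  have meas[measurable]: "clamp \<in> borel_measurable borel" "g \<in> borel_measurable borel"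
    using cont by (auto intro: borel_measurable_continuous_onI)
  have clamp: "clamp x = x \<longleftrightarrow> x \<in> {0..1}" "\<bar>clamp x\<bar> \<le> 1"
    "0 \<le> x \<Longrightarrow> x \<le> 1 \<Longrightarrow> clamp x = x" for x
    by (auto simp: clamp_def)
  have g: "g x = 0 \<longleftrightarrow> x \<in> {0..1}" "0 \<le> g x" "norm (g x) \<le> 1" for x
    using clamp(1)[of x] by (auto simp: g_def min_def)
  have AE_N: "AE x in N. x \<in> {0..1}"
  proof -
    have "integral\<^sup>L ((\<mu> \<circ> r) n) g = 0" for n
      using M1_D(3)[OF \<nu>] by (auto simp: \<mu>_def M1_distr_borel[OF \<nu>] g(1) intro!: integral_eq_zero_AE)
    then have "integral\<^sup>L N g = 0"
      using lim[of g 1] cont(2) g(3) by (simp add: LIMSEQ_const_iff continuous_on_eq_continuous_at)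
    moreover have "integrable N g"
      using g(3) by (intro N.integrable_const_bound[where B = 1]) auto
    ultimately have "AE x in N. g x = 0"
      using g(2) by (subst (asm) integral_nonneg_eq_0_iff_AE) auto
    then show ?thesis by (simp add: g(1))
  qed
  define \<nu>' where "\<nu>' = restrict_space N {0..1}"
  have "emeasure N {0..1} = 1"
    using AE_N by (intro N.emeasure_eq_1_AE) auto
  then have "\<nu>' \<in> M1"
    unfolding M1_def space_prob_algebra \<nu>'_def
    by (auto intro!: prob_space_restrict_space sets_restrict_space_cong)
  moreover have "(y \<circ> r) \<longlonglongrightarrow> moments \<nu>'"
  proof -
    have "(\<lambda>n. moments (\<nu> (r n)) k) \<longlonglongrightarrow> moments \<nu>' k" for k
    proof -
      have "(\<lambda>n. integral\<^sup>L ((\<mu> \<circ> r) n) (\<lambda>x. clamp x ^ k)) \<longlonglongrightarrow> integral\<^sup>L N (\<lambda>x. clamp x ^ k)"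
        using cont(1) clamp(2)
        by (intro lim[of _ 1] continuous_intros) (auto simp: continuous_on_eq_continuous_at power_abs intro: power_le_one)
      moreover have "integral\<^sup>L ((\<mu> \<circ> r) n) (\<lambda>x. clamp x ^ k) = moments (\<nu> (r n)) k" for n
        unfolding moments_def o_def \<mu>_def using M1_D(3)[OF \<nu>]
        by (subst M1_distr_borel[OF \<nu>]) (auto simp: clamp(3) intro!: Bochner_Integration.integral_cong)
      moreover have "integral\<^sup>L N (\<lambda>x. clamp x ^ k) = moments \<nu>' k"
        unfolding moments_def \<nu>'_def
      proof (subst integral_restrict_space)
        show "integral\<^sup>L N (\<lambda>x. clamp x ^ k) = (\<integral>x. indicator {0..1} x *\<^sub>R x ^ k \<partial>N)"
        proof (rule integral_cong_AE)
          show "AE x in N. clamp x ^ k = indicator {0..1} x *\<^sub>R x ^ k"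
            using AE_N by eventually_elim (simp add: clamp(3))
        qed simp_all
      qed auto
      ultimately show ?thesis by simp
    qed
    then have "limitin (product_topology (\<lambda>_. euclidean) UNIV) (y \<circ> r) (moments \<nu>') sequentially"
      by (subst limitin_componentwise) (auto simp: y)
    then show ?thesis
      by (simp add: euclidean_product_topology)
  qed
  ultimately show "\<exists>l\<in>moments ` M1. \<exists>r. strict_mono r \<and> (y \<circ> r) \<longlonglongrightarrow> l"
    using r by blast
qed

lemma compact_space_weak_topology: "compact_space weak_topology"
  unfolding compact_space_alt topspace_weak_topology
proof (intro allI impI, elim conjE)
  fix \<U> assume open_\<U>: "\<forall>U\<in>\<U>. openin weak_topology U" and cover: "M1 \<subseteq> \<Union>\<U>"
  \<comment> \<open>These are the open sets of sequences whose preimage fits into a single member of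
    the cover, so a finite subfamily covering the moment image selects finitely many members of
    \<open>\<U>\<close> covering \<open>M1\<close>.\<close>
  define \<V> where "\<V> = {V. open V \<and> (\<exists>U\<in>\<U>. {\<nu> \<in> M1. moments \<nu> \<in> V} \<subseteq> U)}"
  have "moments \<nu> \<in> \<Union>\<V>" if \<nu>: "\<nu> \<in> M1" for \<nu>
  proof -
    obtain U where U: "U \<in> \<U>" "\<nu> \<in> U" using \<nu> cover by blast
    then have "openin weak_topology U" using open_\<U> by blast
    from weak_topology_moment_neighbourhood[OF this U(2)] U(1) show ?thesis
      unfolding \<V>_def by blast
  qed
  then have "moments ` M1 \<subseteq> \<Union>\<V>" by blast
  moreover have "open V" if "V \<in> \<V>" for V using that by (simp add: \<V>_def)
  ultimately obtain \<D> where \<D>: "\<D> \<subseteq> \<V>" "finite \<D>" "moments ` M1 \<subseteq> \<Union>\<D>"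
    by (rule compactE[OF compact_moments])
  have "\<forall>V\<in>\<D>. \<exists>U. U \<in> \<U> \<and> {\<nu> \<in> M1. moments \<nu> \<in> V} \<subseteq> U"
    using \<D>(1) unfolding \<V>_def by blast
  from bchoice[OF this] obtain u
    where u: "\<And>V. V \<in> \<D> \<Longrightarrow> u V \<in> \<U>" "\<And>V. V \<in> \<D> \<Longrightarrow> {\<nu> \<in> M1. moments \<nu> \<in> V} \<subseteq> u V"
    by blast
  have "M1 \<subseteq> \<Union>(u ` \<D>)"
  proof
    fix \<nu> assume \<nu>: "\<nu> \<in> M1"
    then obtain V where "V \<in> \<D>" "moments \<nu> \<in> V" using \<D>(3) by blast
    with \<nu> u(2)[of V] show "\<nu> \<in> \<Union>(u ` \<D>)" by blast
  qed
  then show "\<exists>\<F>. finite \<F> \<and> \<F> \<subseteq> \<U> \<and> M1 \<subseteq> \<Union>\<F>"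
    using u(1) \<D>(2) by (intro exI[of _ "u ` \<D>"]) auto
qed

subsection \<open>Partition balls and weak neighbourhoods\<close>

lemma M1_Ico_in_sets: "\<nu> \<in> M1 \<Longrightarrow> 0 \<le> a \<Longrightarrow> b \<le> 1 \<Longrightarrow> {a..<b} \<in> sets \<nu>"
  by (auto simp: M1_sets_iff)

lemma M1_measure_Ico:
  assumes \<nu>: "\<nu> \<in> M1" and "0 \<le> a" "a \<le> b" "b \<le> 1"
  shows "measure \<nu> {a..<b} = measure \<nu> {0..<b} - measure \<nu> {0..<a}"
proof -
  interpret prob_space \<nu> by (rule M1_D[OF \<nu>])
  have "{a..<b} = {0..<b} - {0..<a}" using assms by auto
  also have "measure \<nu> \<dots> = measure \<nu> {0..<b} - measure \<nu> {0..<a}"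
    using assms by (intro finite_measure_Diff M1_Ico_in_sets) auto
  finally show ?thesis .
qed

lemma M1_measure_Icc_1:
  assumes \<nu>: "\<nu> \<in> M1" and "0 \<le> a" "a \<le> 1"
  shows "measure \<nu> {a..1} = 1 - measure \<nu> {0..<a}"
proof -
  interpret prob_space \<nu> by (rule M1_D[OF \<nu>])
  have "{a..1} = space \<nu> - {0..<a}" using assms by (auto simp: M1_D[OF \<nu>])
  then show ?thesis
    using assms by (auto simp: M1_Ico_in_sets intro!: prob_compl)
qed

section \<open>Continuous ramps around the indicator of an initial interval\<close>

lemma M1_integral_tendsto_measure:
  fixes f :: "nat \<Rightarrow> real \<Rightarrow> real"
  assumes \<nu>: "\<nu> \<in> M1" and A: "A \<in> sets \<nu>"
    and f: "\<And>k. continuous_on {0..1} (f k)" "\<And>k x. \<bar>f k x\<bar> \<le> 1"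
    and lim: "\<And>x. x \<in> {0..1} \<Longrightarrow> (\<lambda>k. f k x) \<longlonglongrightarrow> indicator A x"
  shows "(\<lambda>k. integral\<^sup>L \<nu> (f k)) \<longlonglongrightarrow> measure \<nu> A"
proof -
  interpret prob_space \<nu> by (rule M1_D[OF \<nu>])
  have "(\<lambda>k. integral\<^sup>L \<nu> (f k)) \<longlonglongrightarrow> integral\<^sup>L \<nu> (indicator A)"
  proof (rule integral_dominated_convergence[where w = "\<lambda>_. 1"])
    show "f k \<in> borel_measurable \<nu>" for k
      using M1_integrable_continuous[OF \<nu> f(1)] by (rule borel_measurable_integrable)
    show "indicator A \<in> borel_measurable \<nu>" using A by simp
  qed (use f lim in \<open>auto simp: M1_D(3)[OF \<nu>]\<close>)
  then show ?thesis
    using sets.sets_into_space[OF A] by (simp add: Int_absorb2)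
qed

text \<open>The two ramps enclose \<open>indicator {..<t}\<close> from below and above. Their
  pointwise limits in \<open>k\<close> differ only at the point \<open>t\<close>, so initial masses
  can be controlled weakly near any measure without an atom at \<open>t\<close>.\<close>

definition lower_ramp :: "real \<Rightarrow> nat \<Rightarrow> real \<Rightarrow> real" where
  "lower_ramp t k x = max 0 (min 1 (real k * (t - x)))"

definition upper_ramp :: "real \<Rightarrow> nat \<Rightarrow> real \<Rightarrow> real" where
  "upper_ramp t k x = max 0 (min 1 (1 - real k * (x - t)))"

lemma continuous_on_ramp: "continuous_on S (lower_ramp t k)" "continuous_on S (upper_ramp t k)"
  unfolding lower_ramp_def upper_ramp_def by (intro continuous_intros)+

lemma ramp_bounds: "0 \<le> lower_ramp t k x" "lower_ramp t k x \<le> 1" "0 \<le> upper_ramp t k x" "upper_ramp t k x \<le> 1"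
  by (auto simp: lower_ramp_def upper_ramp_def)

lemma lower_ramp_eq_0: "t \<le> x \<Longrightarrow> lower_ramp t k x = 0"
  using mult_nonneg_nonpos[of "real k" "t - x"] by (simp add: lower_ramp_def)

lemma upper_ramp_eq_1: "x \<le> t \<Longrightarrow> upper_ramp t k x = 1"
  using mult_nonneg_nonpos[of "real k" "x - t"] by (simp add: upper_ramp_def)

lemma eventually_ge_1_mult:
  assumes "(0::real) < d"
  shows "\<forall>\<^sub>F k in sequentially. 1 \<le> real k * d"
  using eventually_ge_at_top[of "nat \<lceil>1 / d\<rceil>"]
proof eventually_elim
  case (elim k)
  then have "1 / d \<le> real k" by linarith
  then show ?case using assms by (simp add: field_simps)
qed

lemma lower_ramp_tendsto: "(\<lambda>k. lower_ramp t k x) \<longlonglongrightarrow> indicator {..<t} x"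
proof (cases "x < t")
  case True
  then have "\<forall>\<^sub>F k in sequentially. 1 \<le> real k * (t - x)"
    by (intro eventually_ge_1_mult) simp
  then have "\<forall>\<^sub>F k in sequentially. lower_ramp t k x = 1"
    by eventually_elim (simp add: lower_ramp_def)
  with True show ?thesis by (simp add: tendsto_eventually)
qed (simp add: lower_ramp_eq_0)

lemma upper_ramp_tendsto: "(\<lambda>k. upper_ramp t k x) \<longlonglongrightarrow> indicator {..t} x"
proof (cases "t < x")
  case True
  then have "\<forall>\<^sub>F k in sequentially. 1 \<le> real k * (x - t)"
    by (intro eventually_ge_1_mult) simp
  then have "\<forall>\<^sub>F k in sequentially. upper_ramp t k x = 0"
    by eventually_elim (simp add: upper_ramp_def)
  with True show ?thesis by (simp add: tendsto_eventually)
qed (simp add: upper_ramp_eq_1)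

lemma M1_integral_lower_ramp_tendsto:
  assumes "\<nu> \<in> M1" "0 \<le> t" "t \<le> 1"
  shows "(\<lambda>k. integral\<^sup>L \<nu> (lower_ramp t k)) \<longlonglongrightarrow> measure \<nu> {0..<t}"
proof (rule M1_integral_tendsto_measure[OF assms(1)])
  show "(\<lambda>k. lower_ramp t k x) \<longlonglongrightarrow> indicator {0..<t} x" if "x \<in> {0..1}" for x
    using lower_ramp_tendsto[of t x] that by (auto simp: indicator_def)
qed (use assms ramp_bounds in \<open>auto simp: M1_Ico_in_sets continuous_on_ramp\<close>)

lemma M1_integral_upper_ramp_tendsto:
  assumes "\<nu> \<in> M1" "0 \<le> t" "t \<le> 1"
  shows "(\<lambda>k. integral\<^sup>L \<nu> (upper_ramp t k)) \<longlonglongrightarrow> measure \<nu> {0..t}"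
proof (rule M1_integral_tendsto_measure[OF assms(1)])
  show "(\<lambda>k. upper_ramp t k x) \<longlonglongrightarrow> indicator {0..t} x" if "x \<in> {0..1}" for x
    using upper_ramp_tendsto[of t x] that by (auto simp: indicator_def)
qed (use assms ramp_bounds in \<open>auto simp: M1_sets_iff continuous_on_ramp\<close>)

section \<open>Borel measurability of closed partition balls\<close>

lemma space_borel_M1: "space borel_M1 = M1"
  by (simp add: space_borel_of topspace_weak_topology)

lemma borel_measurable_integral_M1:
  fixes f :: "real \<Rightarrow> real"
  assumes "continuous_on {0..1} f"
  shows "(\<lambda>\<nu>. integral\<^sup>L \<nu> f) \<in> borel_measurable borel_M1"
proof (rule borel_measurableI)
  fix U :: "real set" assume "open U"
  have "(\<lambda>\<nu>. integral\<^sup>L \<nu> f) -` U \<inter> space borel_M1 = {\<nu> \<in> M1. (\<integral>x. f x \<partial>\<nu>) \<in> U}"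
    by (auto simp: space_borel_M1)
  then show "(\<lambda>\<nu>. integral\<^sup>L \<nu> f) -` U \<inter> space borel_M1 \<in> sets borel_M1"
    using openin_imp_sets_borel_of[OF openin_weak_topology_integral[OF assms \<open>open U\<close>]] by simp
qed

text \<open>A pointwise limit of the weakly continuous maps that integrate
  \<open>lower_ramp t k\<close>; this covers measures with an atom at \<open>t\<close> as
  well.\<close>

lemma borel_measurable_measure_initial:
  assumes "0 \<le> t" "t \<le> 1"
  shows "(\<lambda>\<nu>. measure \<nu> {0..<t}) \<in> borel_measurable borel_M1"
  by (rule borel_measurable_LIMSEQ_real[OF M1_integral_lower_ramp_tendsto[OF _ assms]])
    (auto simp: space_borel_M1 intro!: borel_measurable_integral_M1 continuous_on_ramp)

lemma borel_measurable_measure_Ico: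
  assumes "0 \<le> a" "a \<le> b" "b \<le> 1"
  shows "(\<lambda>\<nu>. measure \<nu> {a..<b}) \<in> borel_measurable borel_M1"
proof (subst measurable_cong)
  show "measure \<nu> {a..<b} = measure \<nu> {0..<b} - measure \<nu> {0..<a}" if "\<nu> \<in> space borel_M1" for \<nu>
    using that assms by (intro M1_measure_Ico) (auto simp: space_borel_M1)
qed (use assms in \<open>intro borel_measurable_diff borel_measurable_measure_initial; simp\<close>)

lemma borel_measurable_measure_Icc_1:
  assumes "0 \<le> a" "a \<le> 1"
  shows "(\<lambda>\<nu>. measure \<nu> {a..1}) \<in> borel_measurable borel_M1"
proof (subst measurable_cong)
  show "measure \<nu> {a..1} = 1 - measure \<nu> {0..<a}" if "\<nu> \<in> space borel_M1" for \<nu>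
    using that assms by (intro M1_measure_Icc_1) (auto simp: space_borel_M1)
qed (use assms in \<open>intro borel_measurable_diff borel_measurable_measure_initial borel_measurable_const; simp\<close>)

text \<open>With 0 put in front of the list, index \<open>i\<close> denotes the \<open>i\<close>-th
  partition point for all \<open>i \<le> length ts\<close>, the left endpoint included, and the last
  block starts at index \<open>length ts\<close>.\<close>

lemma partition_nth:
  assumes "ts \<in> partitions \<mu>"
  shows "i \<le> j \<Longrightarrow> j \<le> length ts \<Longrightarrow> (0 # ts) ! i \<le> (0 # ts) ! j"
    and "i \<le> length ts \<Longrightarrow> 0 \<le> (0 # ts) ! i"
    and "i \<le> length ts \<Longrightarrow> (0 # ts) ! i < 1"
    and "last ts = (0 # ts) ! length ts"
proof -
  have ts: "ts \<noteq> []" "sorted_wrt (<) (0 # ts)" "set (0 # ts) \<subseteq> {0..<1}"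
    using assms by (auto simp: partitions_def)
  show "(0 # ts) ! i \<le> (0 # ts) ! j" if "i \<le> j" "j \<le> length ts"
    using sorted_wrt_nth_less[OF ts(2), of i j] that by (cases "i = j") auto
  show "0 \<le> (0 # ts) ! i" "(0 # ts) ! i < 1" if "i \<le> length ts"
  proof -
    have "(0 # ts) ! i \<in> set (0 # ts)" using that by (intro nth_mem) simp
    then show "0 \<le> (0 # ts) ! i" "(0 # ts) ! i < 1" using ts(3) by auto
  qed
  show "last ts = (0 # ts) ! length ts"
    using ts(1) by (simp add: last_conv_nth nth_Cons')
qed

lemma partition_nth_Suc:
  assumes "ts \<in> partitions \<mu>" "i < length ts"
  shows "(0 # ts) ! i \<le> ts ! i" "0 \<le> ts ! i" "ts ! i < 1"
  using partition_nth(1)[OF assms(1), of i "Suc i"] partition_nth(2,3)[OF assms(1), of "Suc i"] assms(2)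
  by auto

text \<open>Serves the upper bound, where a closed ball is the larger set in a monotonicity argument
  and must therefore be measurable.\<close>

lemma rho_cball_in_sets:
  assumes ts: "ts \<in> partitions \<mu>'"
  shows "rho_cball ts \<mu> \<delta> \<in> sets borel_M1"
proof -
  have "(\<lambda>\<nu>. rho ts \<nu> \<mu>) \<in> borel_measurable borel_M1"
    unfolding rho_def using partition_nth[OF ts] partition_nth_Suc[OF ts]
    by (intro borel_measurable_add borel_measurable_sum borel_measurable_abs borel_measurable_diff
        borel_measurable_const borel_measurable_measure_Ico borel_measurable_measure_Icc_1)
      (auto intro: less_imp_le)
  then have "{\<nu> \<in> space borel_M1. rho ts \<nu> \<mu> \<le> \<delta>} \<in> sets borel_M1"
    by measurable
  then show ?thesis by (simp add: rho_cball_def space_borel_M1)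
qed

section \<open>Weak neighbourhoods inside partition balls\<close>

lemma weak_neighbourhood_measure_initial:
  assumes \<mu>: "\<mu> \<in> M1" and t: "t \<in> continuity_points \<mu>" and e: "e > 0"
  shows "\<exists>G. openin weak_topology G \<and> \<mu> \<in> G \<and> (\<forall>\<nu>\<in>G. \<bar>measure \<nu> {0..<t} - measure \<mu> {0..<t}\<bar> < e)"
proof -
  interpret prob_space \<mu> by (rule M1_D[OF \<mu>])
  have t01: "0 \<le> t" "t \<le> 1" and t0: "measure \<mu> {t} = 0"
    using t by (auto simp: continuity_points_def)
  \<comment> \<open>Since \<open>\<mu>\<close> has no mass at \<open>t\<close>, the two ramp
    integrals against \<open>\<mu>\<close> have the same limit, and a single \<open>k\<close> brings
    both within \<open>e / 2\<close> of it.\<close>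
  have "{0..t} = {0..<t} \<union> {t}" using t01 by auto
  also have "measure \<mu> \<dots> = measure \<mu> {0..<t} + measure \<mu> {t}"
    using \<mu> t01 by (intro finite_measure_Union) (auto simp: M1_sets_iff)
  finally have closed: "measure \<mu> {0..t} = measure \<mu> {0..<t}" using t0 by simp
  have "\<forall>\<^sub>F k in sequentially. integral\<^sup>L \<mu> (lower_ramp t k) > measure \<mu> {0..<t} - e / 2"
    using M1_integral_lower_ramp_tendsto[OF \<mu> t01] e by (intro order_tendstoD(1)) auto
  moreover have "\<forall>\<^sub>F k in sequentially. integral\<^sup>L \<mu> (upper_ramp t k) < measure \<mu> {0..<t} + e / 2"
    using M1_integral_upper_ramp_tendsto[OF \<mu> t01] e unfolding closed
    by (intro order_tendstoD(2)) auto
  ultimately have "\<forall>\<^sub>F k in sequentially. integral\<^sup>L \<mu> (lower_ramp t k) > measure \<mu> {0..<t} - e / 2 \<and>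
      integral\<^sup>L \<mu> (upper_ramp t k) < measure \<mu> {0..<t} + e / 2"
    by (rule eventually_conj)
  then obtain k where k: "integral\<^sup>L \<mu> (lower_ramp t k) > measure \<mu> {0..<t} - e / 2"
      "integral\<^sup>L \<mu> (upper_ramp t k) < measure \<mu> {0..<t} + e / 2"
    using eventually_happens'[OF sequentially_bot] by blast
  define G where "G = {\<nu> \<in> M1. (\<integral>x. lower_ramp t k x \<partial>\<nu>) \<in> {measure \<mu> {0..<t} - e / 2<..}} \<inter>
    {\<nu> \<in> M1. (\<integral>x. upper_ramp t k x \<partial>\<nu>) \<in> {..<measure \<mu> {0..<t} + e / 2}}"
  have "openin weak_topology G"
    unfolding G_def by (intro openin_Int openin_weak_topology_integral continuous_on_ramp) auto
  moreover have "\<mu> \<in> G" using k \<mu> by (simp add: G_def)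
  moreover have "\<bar>measure \<nu> {0..<t} - measure \<mu> {0..<t}\<bar> < e" if "\<nu> \<in> G" for \<nu>
  proof -
    have \<nu>: "\<nu> \<in> M1" using that by (simp add: G_def)
    interpret \<nu>: prob_space \<nu> by (rule M1_D[OF \<nu>])
    have ind: "integrable \<nu> (indicator {0..<t} :: real \<Rightarrow> real)" "(\<integral>x. indicator {0..<t} x \<partial>\<nu>) = measure \<nu> {0..<t}"
      using M1_Ico_in_sets[OF \<nu>, of 0 t] t01 sets.sets_into_space[of "{0..<t}" \<nu>]
      by (auto simp: Int_absorb2 \<nu>.emeasure_eq_measure)
    \<comment> \<open>The enclosure by ramps holds for every \<open>\<nu>\<close>, even one with an
      atom at \<open>t\<close>; the two open conditions in \<open>G\<close> then bound its initial
      mass from both sides.\<close>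
    have "(\<integral>x. lower_ramp t k x \<partial>\<nu>) \<le> measure \<nu> {0..<t}"
      unfolding ind(2)[symmetric] using lower_ramp_eq_0[of t] ramp_bounds
      by (intro M1_integral_le[OF \<nu>] M1_integrable_continuous[OF \<nu>] continuous_on_ramp ind)
        (auto simp: indicator_def)
    moreover have "measure \<nu> {0..<t} \<le> (\<integral>x. upper_ramp t k x \<partial>\<nu>)"
      unfolding ind(2)[symmetric] using upper_ramp_eq_1[of _ t] ramp_bounds
      by (intro M1_integral_le[OF \<nu>] M1_integrable_continuous[OF \<nu>] continuous_on_ramp ind)
        (auto simp: indicator_def)
    ultimately show ?thesis using that e by (auto simp: G_def abs_less_iff)
  qed
  ultimately show ?thesis by blast
qed

text \<open>The mass of a half-open block is a difference of two initial masses and costs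
  \<open>2 * e\<close>; the last block is the complement of an initial interval and costs
  \<open>e\<close>.\<close>

lemma rho_le_of_initial:
  assumes M1: "\<mu> \<in> M1" "\<nu> \<in> M1" and ts: "ts \<in> partitions \<mu>"
    and le: "\<And>t. t \<in> set (0 # ts) \<Longrightarrow> \<bar>measure \<nu> {0..<t} - measure \<mu> {0..<t}\<bar> \<le> e"
  shows "rho ts \<nu> \<mu> \<le> e + real (length ts) * (2 * e)"
proof -
  have "\<bar>measure \<nu> {last ts..1} - measure \<mu> {last ts..1}\<bar> \<le> e"
  proof -
    have "last ts \<in> set (0 # ts)" "0 \<le> last ts" "last ts \<le> 1"
      using ts partition_nth(2,3)[OF ts, of "length ts"] partition_nth(4)[OF ts]
      by (auto simp: partitions_def)
    then show ?thesis using le[of "last ts"] by (simp add: M1_measure_Icc_1 M1 abs_minus_commute)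
  qed
  moreover have "(\<Sum>i<length ts. \<bar>measure \<nu> {(0 # ts) ! i..<ts ! i} - measure \<mu> {(0 # ts) ! i..<ts ! i}\<bar>)
      \<le> (\<Sum>i<length ts. 2 * e)"
  proof (rule sum_mono)
    fix i assume "i \<in> {..<length ts}"
    then have i: "i < length ts" by simp
    have "measure \<kappa> {(0 # ts) ! i..<ts ! i} = measure \<kappa> {0..<ts ! i} - measure \<kappa> {0..<(0 # ts) ! i}"
      if "\<kappa> \<in> M1" for \<kappa>
      using partition_nth_Suc[OF ts i] partition_nth(2)[OF ts, of i] i
      by (intro M1_measure_Ico that) auto
    note split = this[OF M1(1)] this[OF M1(2)]
    have "(0 # ts) ! i \<in> set (0 # ts)" using i by (intro nth_mem) simp
    note le[OF this]
    moreover have "ts ! i \<in> set (0 # ts)" using i by simp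
    note le[OF this]
    ultimately show "\<bar>measure \<nu> {(0 # ts) ! i..<ts ! i} - measure \<mu> {(0 # ts) ! i..<ts ! i}\<bar> \<le> 2 * e"
      unfolding split by linarith
  qed
  ultimately show ?thesis by (simp add: rho_def)
qed

lemma rho_ball_weak_neighbourhood:
  assumes \<mu>: "\<mu> \<in> M1" and ts: "ts \<in> partitions \<mu>" and \<delta>: "\<delta> > 0"
  shows "\<exists>G. openin weak_topology G \<and> \<mu> \<in> G \<and> G \<subseteq> rho_ball ts \<mu> \<delta>"
proof -
  \<comment> \<open>Chosen so that the bound \<open>e + real (length ts) * (2 * e)\<close> of
    \<open>rho_le_of_initial\<close> falls strictly below \<open>\<delta>\<close>.\<close>
  define e where "e = \<delta> / (2 + 2 * real (length ts))"
  have e: "e > 0" using \<delta> by (simp add: e_def)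
  have "\<exists>G. openin weak_topology G \<and> \<mu> \<in> G \<and>
      (\<forall>\<nu>\<in>G. \<bar>measure \<nu> {0..<t} - measure \<mu> {0..<t}\<bar> < e)" if "t \<in> set (0 # ts)" for t
  \<comment> \<open>The endpoint 0 may be an atom of \<open>\<mu>\<close>, but
    \<open>{0..<0}\<close> is empty, so the whole space serves as its neighbourhood.\<close>
  proof (cases "t = 0")
    case True
    then show ?thesis using e \<mu> openin_topspace[of weak_topology]
      by (intro exI[of _ M1]) (simp add: topspace_weak_topology)
  next
    case False
    then have "t \<in> continuity_points \<mu>" using ts that by (auto simp: partitions_def)
    then show ?thesis using weak_neighbourhood_measure_initial[OF \<mu> _ e] by blast
  qed
  then obtain G where G: "\<And>t. t \<in> set (0 # ts) \<Longrightarrow> openin weak_topology (G t)"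
    "\<And>t. t \<in> set (0 # ts) \<Longrightarrow> \<mu> \<in> G t"
    "\<And>t \<nu>. t \<in> set (0 # ts) \<Longrightarrow> \<nu> \<in> G t \<Longrightarrow> \<bar>measure \<nu> {0..<t} - measure \<mu> {0..<t}\<bar> < e"
    by metis
  let ?G = "\<Inter>(G ` set (0 # ts))"
  have "openin weak_topology ?G" using G(1) by (intro openin_Inter) auto
  moreover have "\<mu> \<in> ?G" using G(2) by blast
  moreover have "?G \<subseteq> rho_ball ts \<mu> \<delta>"
  proof
    fix \<nu> assume \<nu>: "\<nu> \<in> ?G"
    then have "\<nu> \<in> M1"
      using openin_subset[OF \<open>openin weak_topology ?G\<close>] by (auto simp: topspace_weak_topology)
    moreover have "rho ts \<nu> \<mu> \<le> e + real (length ts) * (2 * e)"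
      using G(3) \<nu> by (intro rho_le_of_initial \<mu> \<open>\<nu> \<in> M1\<close> ts less_imp_le) blast
    moreover have "e + real (length ts) * (2 * e) < e * (2 + 2 * real (length ts))"
      using e by (simp add: algebra_simps)
    moreover have "e * (2 + 2 * real (length ts)) = \<delta>" by (simp add: e_def)
    ultimately show "\<nu> \<in> rho_ball ts \<mu> \<delta>" by (simp add: rho_ball_def)
  qed
  ultimately show ?thesis by blast
qed

section \<open>Partition balls inside weak neighbourhoods\<close>

lemma sum_indicator_consecutive:
  fixes T :: "nat \<Rightarrow> real"
  assumes "\<And>i. i < m \<Longrightarrow> T i \<le> T (Suc i)"
  shows "(\<Sum>i<m. indicator {T i..<T (Suc i)} x) = (indicator {T 0..<T m} x :: real)"
  using assms
proof (induction m)
  case (Suc m)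
  have "T 0 \<le> T n" if "n \<le> m" for n
    using that by (induction n) (auto intro: order_trans[OF _ Suc.prems])
  then have "T 0 \<le> T m" by blast
  moreover have "T m \<le> T (Suc m)" using Suc.prems by simp
  moreover have "(\<Sum>i<m. indicator {T i..<T (Suc i)} x) = (indicator {T 0..<T m} x :: real)"
    using Suc by simp
  ultimately show ?case unfolding sum.lessThan_Suc by (auto simp: indicator_def split: if_splits)
qed simp

definition mesh_less :: "real list \<Rightarrow> real \<Rightarrow> bool" where
  "mesh_less ts \<eta> \<longleftrightarrow> 1 - last ts < \<eta> \<and> (\<forall>i<length ts. ts ! i - (0 # ts) ! i < \<eta>)"

text \<open>Both integrals are compared with that of the step function \<open>s\<close> taking the
  value of \<open>f\<close> at the left end of each block. Each replacement costs \<open>e\<close>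
  by the modulus of continuity, and the integrals of \<open>s\<close> differ by at most
  \<open>B\<close> times the total discrepancy of block masses.\<close>

lemma integral_diff_le_rho:
  fixes f :: "real \<Rightarrow> real"
  assumes M1: "\<mu> \<in> M1" "\<nu> \<in> M1" and ts: "ts \<in> partitions \<mu>" and mesh: "mesh_less ts \<eta>"
    and f: "continuous_on {0..1} f" and B: "\<And>x. x \<in> {0..1} \<Longrightarrow> \<bar>f x\<bar> \<le> B"
    and modulus: "\<And>x y. x \<in> {0..1} \<Longrightarrow> y \<in> {0..1} \<Longrightarrow> \<bar>x - y\<bar> < \<eta> \<Longrightarrow> \<bar>f x - f y\<bar> \<le> e"
  shows "\<bar>integral\<^sup>L \<nu> f - integral\<^sup>L \<mu> f\<bar> \<le> 2 * e + B * rho ts \<nu> \<mu>"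
proof -
  define m where "m = length ts"
  define T where "T i = (0 # ts) ! i" for i
  have T01: "0 \<le> T i" "T i \<le> 1" if "i \<le> m" for i
    using partition_nth(2,3)[OF ts, of i] that by (auto simp: T_def m_def)
  have T_mono: "T i \<le> T (Suc i)" if "i < m" for i
    using partition_nth(1)[OF ts, of i "Suc i"] that by (auto simp: T_def m_def)
  have T_mesh: "T (Suc i) - T i < \<eta>" if "i < m" for i
    using mesh that by (auto simp: mesh_less_def T_def m_def)
  have Tm: "last ts = T m" "1 - T m < \<eta>"
    using partition_nth(4)[OF ts] mesh by (auto simp: mesh_less_def T_def m_def)
  have T0: "T 0 = 0" by (simp add: T_def)
  have rho: "rho ts \<nu> \<mu> = \<bar>measure \<nu> {T m..1} - measure \<mu> {T m..1}\<bar>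
     + (\<Sum>i<m. \<bar>measure \<nu> {T i..<T (Suc i)} - measure \<mu> {T i..<T (Suc i)}\<bar>)"
    unfolding rho_def Tm(1) by (simp add: T_def m_def)
  define s where "s x = f (T m) * indicator {T m..1} x
    + (\<Sum>i<m. f (T i) * indicator {T i..<T (Suc i)} x)" for x
  have near: "\<bar>f x - s x\<bar> \<le> e" if x: "x \<in> {0..1}" for x
  proof -
    \<comment> \<open>The blocks partition the unit interval, so \<open>f x\<close> can be
      distributed over them and compared with \<open>s x\<close> block by block.\<close>
    have one: "indicator {T m..1} x + (\<Sum>i<m. indicator {T i..<T (Suc i)} x) = (1::real)"
      using sum_indicator_consecutive[of m T x] T_mono x T0 by (auto simp: indicator_def)
    have "f x - s x = (f x - f (T m)) * indicator {T m..1} x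
        + (\<Sum>i<m. (f x - f (T i)) * indicator {T i..<T (Suc i)} x)"
    proof -
      have "f x = f x * (indicator {T m..1} x + (\<Sum>i<m. indicator {T i..<T (Suc i)} x))"
        using one by simp
      then show ?thesis
        unfolding s_def by (simp add: left_diff_distrib sum_subtractf sum_distrib_left distrib_left)
    qed
    also have "\<bar>\<dots>\<bar> \<le> \<bar>(f x - f (T m)) * indicator {T m..1} x\<bar>
        + (\<Sum>i<m. \<bar>(f x - f (T i)) * indicator {T i..<T (Suc i)} x\<bar>)"
      using sum_abs by (rule order_trans[OF abs_triangle_ineq add_left_mono])
    also have "\<dots> \<le> e * indicator {T m..1} x + (\<Sum>i<m. e * indicator {T i..<T (Suc i)} x)"
    proof (intro add_mono sum_mono)
      show "\<bar>(f x - f (T m)) * indicator {T m..1} x\<bar> \<le> e * indicator {T m..1} x"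
        using modulus[OF x, of "T m"] Tm(2) T01[of m] x by (auto simp: indicator_def)
      fix i assume "i \<in> {..<m}"
      then show "\<bar>(f x - f (T i)) * indicator {T i..<T (Suc i)} x\<bar> \<le> e * indicator {T i..<T (Suc i)} x"
        using modulus[OF x, of "T i"] T_mesh[of i] T01[of i] x by (auto simp: indicator_def)
    qed
    also have "\<dots> = e * (indicator {T m..1} x + (\<Sum>i<m. indicator {T i..<T (Suc i)} x))"
      by (simp add: distrib_left sum_distrib_left)
    finally show ?thesis by (simp add: one)
  qed
  have int_s: "integrable \<kappa> s" "integral\<^sup>L \<kappa> s = f (T m) * measure \<kappa> {T m..1}
      + (\<Sum>i<m. f (T i) * measure \<kappa> {T i..<T (Suc i)})" if \<kappa>: "\<kappa> \<in> M1" for \<kappa>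
  proof -
    interpret \<kappa>: prob_space \<kappa> by (rule M1_D[OF \<kappa>])
    have ind: "integrable \<kappa> (indicator A :: real \<Rightarrow> real)" "integral\<^sup>L \<kappa> (indicator A) = measure \<kappa> A"
      if "A \<in> sets \<kappa>" for A
      using that sets.sets_into_space[OF that] by (auto simp: Int_absorb2 \<kappa>.emeasure_eq_measure)
    have sets: "{T m..1} \<in> sets \<kappa>" "\<And>i. i < m \<Longrightarrow> {T i..<T (Suc i)} \<in> sets \<kappa>"
      using T01 by (auto simp: M1_sets_iff[OF \<kappa>]) (meson T01 Suc_leI less_imp_le order_trans)+
    have int: "integrable \<kappa> (\<lambda>x. f (T m) * indicator {T m..1} x)"
      "\<And>i. i < m \<Longrightarrow> integrable \<kappa> (\<lambda>x. f (T i) * indicator {T i..<T (Suc i)} x)"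
      using sets by (intro integrable_mult_right ind; simp)+
    then have int': "integrable \<kappa> (\<lambda>x. \<Sum>i<m. f (T i) * indicator {T i..<T (Suc i)} x)"
      by (intro Bochner_Integration.integrable_sum) simp
    show "integrable \<kappa> s"
      unfolding s_def using int(1) int' by (rule Bochner_Integration.integrable_add)
    show "integral\<^sup>L \<kappa> s = f (T m) * measure \<kappa> {T m..1} + (\<Sum>i<m. f (T i) * measure \<kappa> {T i..<T (Suc i)})"
      unfolding s_def Bochner_Integration.integral_add[OF int(1) int']
      using int(2) sets by (subst Bochner_Integration.integral_sum) (auto simp: ind)
  qed
  have close: "\<bar>integral\<^sup>L \<kappa> f - integral\<^sup>L \<kappa> s\<bar> \<le> e" if "\<kappa> \<in> M1" for \<kappa>
    using that near by (intro M1_integral_dist_le M1_integrable_continuous f int_s)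
  have "integral\<^sup>L \<nu> s - integral\<^sup>L \<mu> s = f (T m) * (measure \<nu> {T m..1} - measure \<mu> {T m..1})
      + (\<Sum>i<m. f (T i) * (measure \<nu> {T i..<T (Suc i)} - measure \<mu> {T i..<T (Suc i)}))"
    by (simp add: int_s M1 right_diff_distrib sum_subtractf)
  also have "\<bar>\<dots>\<bar> \<le> \<bar>f (T m) * (measure \<nu> {T m..1} - measure \<mu> {T m..1})\<bar>
      + (\<Sum>i<m. \<bar>f (T i) * (measure \<nu> {T i..<T (Suc i)} - measure \<mu> {T i..<T (Suc i)})\<bar>)"
    using sum_abs by (rule order_trans[OF abs_triangle_ineq add_left_mono])
  also have "\<dots> \<le> B * \<bar>measure \<nu> {T m..1} - measure \<mu> {T m..1}\<bar>
      + (\<Sum>i<m. B * \<bar>measure \<nu> {T i..<T (Suc i)} - measure \<mu> {T i..<T (Suc i)}\<bar>)"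
    unfolding abs_mult using T01 by (intro add_mono sum_mono mult_right_mono B) auto
  also have "\<dots> = B * rho ts \<nu> \<mu>"
    by (simp add: rho distrib_left sum_distrib_left)
  finally show ?thesis using close[OF M1(1)] close[OF M1(2)] by linarith
qed

text \<open>A finite measure has countably many atoms, so each open interval between consecutive
  multiples of \<open>1 / N\<close> contains a continuity point. Points from neighbouring intervals
  are less than \<open>2 / N\<close> apart.\<close>

lemma fine_partition_exists:
  assumes \<mu>: "\<mu> \<in> M1" and \<eta>: "\<eta> > 0"
  shows "\<exists>ts\<in>partitions \<mu>. mesh_less ts \<eta>"
proof -
  interpret prob_space \<mu> by (rule M1_D[OF \<mu>])
  obtain N where N: "real N > 2 / \<eta>" using reals_Archimedean2 by blast
  moreover have "2 / \<eta> > 0" using \<eta> by simp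
  ultimately have N0: "N > 0" by (intro Nat.gr0I) simp
  have N2: "2 / real N < \<eta>" using N N0 \<eta> by (simp add: field_simps)
  have "\<exists>t. t \<in> continuity_points \<mu> \<and> real i / real N < t \<and> t < real (Suc i) / real N" if "i < N" for i
  proof -
    have lt: "real i / real N < real (Suc i) / real N" using N0 by (simp add: divide_strict_right_mono)
    have "{real i / real N<..<real (Suc i) / real N} - {x. measure \<mu> {x} \<noteq> 0} \<noteq> {}"
      using uncountable_minus_countable[OF _ countable_support] lt
      by (metis countable_empty uncountable_open_interval)
    then obtain t where "t \<in> {real i / real N<..<real (Suc i) / real N}" "measure \<mu> {t} = 0"
      by blast
    moreover have "0 \<le> real i / real N" "real (Suc i) / real N \<le> 1" using that by auto
    ultimately have "t \<in> continuity_points \<mu>"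
      unfolding continuity_points_def mem_Collect_eq atLeastAtMost_iff greaterThanLessThan_iff
      by linarith
    with \<open>t \<in> {_<..<_}\<close> show ?thesis by auto
  qed
  then obtain t where t: "\<And>i. i < N \<Longrightarrow> t i \<in> continuity_points \<mu>"
    "\<And>i. i < N \<Longrightarrow> real i / real N < t i" "\<And>i. i < N \<Longrightarrow> t i < real (Suc i) / real N"
    by metis
  define ts where "ts = map t [0..<N]"
  have t01: "0 < t i" "t i < 1" if "i < N" for i
  proof -
    have "0 \<le> real i / real N" "real (Suc i) / real N \<le> 1" using that by auto
    then show "0 < t i" "t i < 1" using t(2,3)[OF that] by linarith+
  qed
  have t_less: "t i < t j" if "i < j" "j < N" for i j
  proof -
    have "t i < real (Suc i) / real N" using that by (intro t) simp
    also have "\<dots> \<le> real j / real N" using that by (intro divide_right_mono) auto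
    also have "\<dots> < t j" using that by (intro t)
    finally show ?thesis .
  qed
  have "ts \<in> partitions \<mu>"
    unfolding partitions_def ts_def using N0 t(1) t01 t_less
    by (auto simp: sorted_wrt_iff_nth_less)
  moreover have "mesh_less ts \<eta>"
    unfolding mesh_less_def
  proof (intro conjI allI impI)
    have "real (N - 1) / real N < t (N - 1)" using N0 by (intro t) simp
    moreover have "real (N - 1) / real N = 1 - 1 / real N"
      using N0 by (simp add: of_nat_diff diff_divide_distrib)
    moreover have "1 / real N \<le> 2 / real N" by (simp add: divide_right_mono)
    moreover have "last ts = t (N - 1)" using N0 by (simp add: ts_def last_map)
    ultimately show "1 - last ts < \<eta>" using N2 by simp
    fix i assume "i < length ts"
    then have i: "i < N" by (simp add: ts_def)
    \<comment> \<open>For \<open>i = 0\<close> truncated subtraction yields 0, matching the left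
      endpoint, so one estimate serves the first block and all later ones.\<close>
    have "real (i - 1) / real N \<le> (0 # ts) ! i"
      using i t(2)[of "i - 1"] by (cases i) (auto simp: ts_def)
    moreover have "real (Suc i) / real N \<le> real (i - 1) / real N + 2 / real N"
      unfolding add_divide_distrib[symmetric] by (intro divide_right_mono) auto
    moreover have "ts ! i < real (Suc i) / real N" using i t(3) by (simp add: ts_def)
    ultimately show "ts ! i - (0 # ts) ! i < \<eta>" using N2 by linarith
  qed
  ultimately show ?thesis by blast
qed

text \<open>Claiming the inclusion for every sufficiently fine partition makes the induction pass
  through intersections: the smaller of two mesh bounds works for both sets, whereas two particular
  partitions would need a common refinement.\<close>

lemma weak_open_contains_fine_rho_balls:
  assumes "openin weak_topology U" "\<mu> \<in> U"
  shows "\<exists>\<eta>>0. \<forall>ts\<in>partitions \<mu>. mesh_less ts \<eta> \<longrightarrow> (\<exists>\<delta>>0. rho_ball ts \<mu> \<delta> \<subseteq> U)"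
proof -
  have "generate_topology_on {{\<nu> \<in> M1. (\<integral>x. f x \<partial>\<nu>) \<in> U} | (f :: real \<Rightarrow> real) (U :: real set).
        continuous_on {0..1} f \<and> open U} U"
    using assms(1) unfolding weak_topology_def by (rule openin_topology_generated_by)
  then show ?thesis using assms(2)
  proof (induction U)
    case Empty
    then show ?case by simp
  next
    case (Int a b)
    then obtain \<eta> \<eta>' where
      *: "\<eta> > 0" "\<And>ts. ts \<in> partitions \<mu> \<Longrightarrow> mesh_less ts \<eta> \<Longrightarrow> \<exists>\<delta>>0. rho_ball ts \<mu> \<delta> \<subseteq> a"
      "\<eta>' > 0" "\<And>ts. ts \<in> partitions \<mu> \<Longrightarrow> mesh_less ts \<eta>' \<Longrightarrow> \<exists>\<delta>>0. rho_ball ts \<mu> \<delta> \<subseteq> b"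
      by (metis IntE)
    have "\<exists>\<delta>>0. rho_ball ts \<mu> \<delta> \<subseteq> a \<inter> b" if ts: "ts \<in> partitions \<mu>" "mesh_less ts (min \<eta> \<eta>')" for ts
    proof -
      have "mesh_less ts \<eta>" "mesh_less ts \<eta>'" using ts(2) by (auto simp: mesh_less_def)
      then obtain \<delta> \<delta>' where "\<delta> > 0" "rho_ball ts \<mu> \<delta> \<subseteq> a" "\<delta>' > 0" "rho_ball ts \<mu> \<delta>' \<subseteq> b"
        using *(2,4)[OF ts(1)] by blast
      then show ?thesis by (intro exI[of _ "min \<delta> \<delta>'"]) (auto simp: rho_ball_def)
    qed
    then show ?case using *(1,3) by (intro exI[of _ "min \<eta> \<eta>'"]) auto
  next
    case (UN K)
    then obtain k where k: "k \<in> K" "\<mu> \<in> k" by blast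
    from UN.IH[OF this] show ?case using k(1) by (meson Union_upper order_trans)
  next
    case (Basis s)
    then obtain f :: "real \<Rightarrow> real" and U where s: "s = {\<nu> \<in> M1. (\<integral>x. f x \<partial>\<nu>) \<in> U}"
      and f: "continuous_on {0..1} f" and U: "open U" by blast
    with Basis have \<mu>: "\<mu> \<in> M1" "(\<integral>x. f x \<partial>\<mu>) \<in> U" by auto
    obtain e where e: "e > 0" "ball (\<integral>x. f x \<partial>\<mu>) e \<subseteq> U"
      using U \<mu>(2) open_contains_ball by blast
    obtain B where B: "B > 0" "\<And>x. x \<in> {0..1} \<Longrightarrow> \<bar>f x\<bar> \<le> B"
      using compact_imp_bounded[OF compact_continuous_image[OF f compact_Icc]]
      unfolding bounded_pos real_norm_def by blast
    have "uniformly_continuous_on {0..1} f"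
      using f compact_Icc by (rule compact_uniformly_continuous)
    then obtain \<eta> where \<eta>: "\<eta> > 0"
      "\<And>x y. x \<in> {0..1} \<Longrightarrow> y \<in> {0..1} \<Longrightarrow> \<bar>x - y\<bar> < \<eta> \<Longrightarrow> \<bar>f x - f y\<bar> < e / 4"
      unfolding uniformly_continuous_on_def dist_real_def using e(1)
      by (metis divide_pos_pos zero_less_numeral)
    \<comment> \<open>This radius keeps \<open>B * rho ts \<nu> \<mu>\<close> below
      \<open>e / 2\<close>; the modulus \<open>e / 4\<close>, spent once for each of the two
      measures, uses the other half.\<close>
    have "rho_ball ts \<mu> (e / (2 * B)) \<subseteq> s" if ts: "ts \<in> partitions \<mu>" "mesh_less ts \<eta>" for ts
    proof
      fix \<nu> assume "\<nu> \<in> rho_ball ts \<mu> (e / (2 * B))"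
      then have \<nu>: "\<nu> \<in> M1" "rho ts \<nu> \<mu> < e / (2 * B)" by (auto simp: rho_ball_def)
      have "B * rho ts \<nu> \<mu> < e / 2" using \<nu>(2) B(1) by (simp add: field_simps)
      moreover have "\<bar>integral\<^sup>L \<nu> f - integral\<^sup>L \<mu> f\<bar> \<le> 2 * (e / 4) + B * rho ts \<nu> \<mu>"
        by (rule integral_diff_le_rho[OF \<mu>(1) \<nu>(1) ts f B(2) less_imp_le[OF \<eta>(2)]])
      ultimately have "integral\<^sup>L \<nu> f \<in> ball (integral\<^sup>L \<mu> f) e"
        unfolding mem_ball dist_real_def by linarith
      then show "\<nu> \<in> s" using \<nu>(1) e(2) by (auto simp: s)
    qed
    then show ?case using \<eta>(1) e(1) B(1) by (metis divide_pos_pos mult_pos_pos zero_less_numeral)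
  qed
qed

lemma weak_open_contains_rho_ball:
  assumes "openin weak_topology U" "\<mu> \<in> U"
  obtains ts \<delta> where "ts \<in> partitions \<mu>" "\<delta> > 0" "rho_ball ts \<mu> \<delta> \<subseteq> U"
proof -
  obtain \<eta> where \<eta>: "\<eta> > 0"
    "\<forall>ts\<in>partitions \<mu>. mesh_less ts \<eta> \<longrightarrow> (\<exists>\<delta>>0. rho_ball ts \<mu> \<delta> \<subseteq> U)"
    using weak_open_contains_fine_rho_balls[OF assms] by blast
  have "\<mu> \<in> M1" using openin_subset[OF assms(1)] assms(2) by (auto simp: topspace_weak_topology)
  then obtain ts where "ts \<in> partitions \<mu>" "mesh_less ts \<eta>"
    using fine_partition_exists \<eta>(1) by blast
  with \<eta>(2) that show thesis by blast
qed

section \<open>Local rates of the weighted laws\<close>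

text \<open>If \<open>f\<close> is not measurable, \<^const>\<open>distr\<close> takes the junk value of \<^const>\<open>measure_of\<close>:
  the null measure, unless the push-forward happens to be a measure.\<close>

lemma (in finite_measure) finite_measure_distr_any: "finite_measure (distr M N f)"
proof
  have "emeasure (distr M N f) (space (distr M N f)) \<le> emeasure M (space M)"
    unfolding distr_def emeasure_measure_of_conv by (auto intro: emeasure_space)
  then show "emeasure (distr M N f) (space (distr M N f)) \<noteq> \<infinity>"
    by (auto simp: top_unique)
qed

theorem theorem2p1:
  fixes M :: "'a measure"
    and Z :: "nat \<Rightarrow> 'a \<Rightarrow> real measure"
    and W :: "nat \<Rightarrow> nat \<Rightarrow> 'a \<Rightarrow> real"
    and P :: "real measure measure"
    and J :: "real list \<Rightarrow> real measure \<Rightarrow> ereal"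
  assumes "prob_space M"
    and Z_indep: "prob_space.indep_vars M (\<lambda>_. borel_M1) Z {1..}"
    and Z_law: "\<And>i. i \<ge> 1 \<Longrightarrow> distr M borel_M1 (Z i) = P"
    and W_rv: "\<And>n i. (n, i) \<in> array_indices \<Longrightarrow> W n i \<in> borel_measurable M"
    and W_pos: "\<And>n i \<omega>. (n, i) \<in> array_indices \<Longrightarrow> \<omega> \<in> space M \<Longrightarrow> W n i \<omega> > 0"
    and Z_W_indep: "indep_rvs M
          (\<Pi>\<^sub>M i\<in>{1..}. borel_M1) (\<lambda>\<omega>. \<lambda>i\<in>{1..}. Z i \<omega>)
          (\<Pi>\<^sub>M p\<in>array_indices. (borel :: real measure)) (\<lambda>\<omega>. \<lambda>p\<in>array_indices. W (fst p) (snd p) \<omega>)"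
    and W_lim: "(\<lambda>n. prob_space.expectation M (\<lambda>\<omega>. \<Sum>i=1..n. (normalized W n i \<omega>)\<^sup>2)) \<longlonglongrightarrow> 0"
    and J_nonneg: "\<And>\<mu> ts. \<mu> \<in> M1 \<Longrightarrow> ts \<in> partitions \<mu> \<Longrightarrow> J ts \<mu> \<ge> 0"
    and J_lower: "\<And>\<mu> ts. \<mu> \<in> M1 \<Longrightarrow> ts \<in> partitions \<mu> \<Longrightarrow>
          ((\<lambda>\<delta>. liminf (\<lambda>n. ereal (1 / real n) * elog (measure (weighted_law M Z W n) (rho_ball ts \<mu> \<delta>))))
             \<longlongrightarrow> - J ts \<mu>) (at_right 0)"
    and J_upper: "\<And>\<mu> ts. \<mu> \<in> M1 \<Longrightarrow> ts \<in> partitions \<mu> \<Longrightarrow>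
          ((\<lambda>\<delta>. limsup (\<lambda>n. ereal (1 / real n) * elog (measure (weighted_law M Z W n) (rho_cball ts \<mu> \<delta>))))
             \<longlongrightarrow> - J ts \<mu>) (at_right 0)"
  shows "good_rate_function weak_topology (\<lambda>\<mu>. SUP ts\<in>partitions \<mu>. J ts \<mu>) \<and>
         satisfies_ldp weak_topology (weighted_law M Z W) (\<lambda>\<mu>. SUP ts\<in>partitions \<mu>. J ts \<mu>)"
proof (rule ldp_of_local_bounds[OF compact_space_weak_topology])
  interpret prob_space M by fact
  show fin: "finite_measure (weighted_law M Z W n)" for n
    unfolding weighted_law_def by (rule finite_measure_distr_any)
  show sets: "sets (weighted_law M Z W n) = sets borel_M1" for n
    by (simp add: weighted_law_def)
  show "0 \<le> (SUP ts\<in>partitions \<mu>. J ts \<mu>)" if "\<mu> \<in> topspace weak_topology" for \<mu>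
  proof -
    have \<mu>: "\<mu> \<in> M1" using that by (simp add: topspace_weak_topology)
    \<comment> \<open>An empty supremum would be \<open>-\<infinity>\<close>, so nonnegativity rests
      on the existence of a partition; the mesh bound 1 is arbitrary.\<close>
    obtain ts where ts: "ts \<in> partitions \<mu>" using fine_partition_exists[OF \<mu> zero_less_one] by blast
    show ?thesis
      by (rule order_trans[OF J_nonneg[OF \<mu> ts] SUP_upper[OF ts, of "\<lambda>ts. J ts \<mu>"]])
  qed
  show "- (SUP ts\<in>partitions \<mu>. J ts \<mu>)
      \<le> liminf (\<lambda>n. ereal (1 / real n) * elog (measure (weighted_law M Z W n) G))"
    if G: "openin weak_topology G" "\<mu> \<in> G" for G \<mu>
  proof -
    have \<mu>: "\<mu> \<in> M1" using openin_subset[OF G(1)] G(2) by (auto simp: topspace_weak_topology)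
    obtain ts \<delta> where ts: "ts \<in> partitions \<mu>" and \<delta>: "\<delta> > 0" "rho_ball ts \<mu> \<delta> \<subseteq> G"
      using weak_open_contains_rho_ball[OF G] by blast
    \<comment> \<open>\<open>J_lower\<close> speaks of radii tending to 0, so the comparison with
      \<open>G\<close> is made for all small radii before passing to the limit. The inequality for
      this one partition is enough, because the supremum dominates
      \<open>J ts \<mu>\<close>.\<close>
    have "\<forall>\<^sub>F \<epsilon> in at_right 0. \<epsilon> < \<delta>"
      using \<delta>(1) eventually_at_right_less order_tendstoD(2)[OF tendsto_ident_at, of 0 \<delta>] by blast
    then have "\<forall>\<^sub>F \<epsilon> in at_right 0.
        liminf (\<lambda>n. ereal (1 / real n) * elog (measure (weighted_law M Z W n) (rho_ball ts \<mu> \<epsilon>)))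
        \<le> liminf (\<lambda>n. ereal (1 / real n) * elog (measure (weighted_law M Z W n) G))"
    proof eventually_elim
      case (elim \<epsilon>)
      then have "rho_ball ts \<mu> \<epsilon> \<subseteq> G" using \<delta>(2) by (auto simp: rho_ball_def)
      then show ?case
        by (intro Liminf_mono always_eventually allI finite_measure.scaled_elog_measure_mono fin)
          (auto simp: sets intro: openin_imp_sets_borel_of G)
    qed
    then have "- J ts \<mu> \<le> liminf (\<lambda>n. ereal (1 / real n) * elog (measure (weighted_law M Z W n) G))"
      by (intro tendsto_upperbound[OF J_lower[OF \<mu> ts]]) auto
    moreover have "- (SUP ts\<in>partitions \<mu>. J ts \<mu>) \<le> - J ts \<mu>"
      using SUP_upper[OF ts, of "\<lambda>ts. J ts \<mu>"] by simp
    ultimately show ?thesis by (rule order_trans[rotated])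
  qed
  show "\<exists>G. openin weak_topology G \<and> \<mu> \<in> G \<and>
      limsup (\<lambda>n. ereal (1 / real n) * elog (measure (weighted_law M Z W n) G)) < - ereal a"
    if \<mu>: "\<mu> \<in> topspace weak_topology" and a: "ereal a < (SUP ts\<in>partitions \<mu>. J ts \<mu>)" for \<mu> a
  proof -
    have \<mu>: "\<mu> \<in> M1" using \<mu> by (simp add: topspace_weak_topology)
    obtain ts where ts: "ts \<in> partitions \<mu>" and "ereal a < J ts \<mu>"
      using a by (auto simp: less_SUP_iff)
    then have "- J ts \<mu> < - ereal a" by (simp only: ereal_minus_less_minus)
    \<comment> \<open>One partition already exceeds \<open>a\<close>, so a small closed ball for it
      has upper rate below \<open>- a\<close>; a weak neighbourhood inside that ball inherits the
      bound by monotonicity.\<close>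
    from order_tendstoD(2)[OF J_upper[OF \<mu> ts] this]
    have "\<forall>\<^sub>F \<delta> in at_right 0. 0 < \<delta> \<and>
        limsup (\<lambda>n. ereal (1 / real n) * elog (measure (weighted_law M Z W n) (rho_cball ts \<mu> \<delta>))) < - ereal a"
      using eventually_at_right_less by (rule eventually_conj[rotated])
    then obtain \<delta> where \<delta>: "0 < \<delta>" and less:
      "limsup (\<lambda>n. ereal (1 / real n) * elog (measure (weighted_law M Z W n) (rho_cball ts \<mu> \<delta>))) < - ereal a"
      using eventually_happens'[OF trivial_limit_at_right_real] by blast
    obtain G where G: "openin weak_topology G" "\<mu> \<in> G" "G \<subseteq> rho_ball ts \<mu> \<delta>"
      using rho_ball_weak_neighbourhood[OF \<mu> ts \<delta>] by blast
    then have "G \<subseteq> rho_cball ts \<mu> \<delta>" by (auto simp: rho_ball_def rho_cball_def)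
    then have "limsup (\<lambda>n. ereal (1 / real n) * elog (measure (weighted_law M Z W n) G))
        \<le> limsup (\<lambda>n. ereal (1 / real n) * elog (measure (weighted_law M Z W n) (rho_cball ts \<mu> \<delta>)))"
      by (intro Limsup_mono always_eventually allI finite_measure.scaled_elog_measure_mono fin)
        (auto simp: sets intro: rho_cball_in_sets[OF ts])
    then show ?thesis using G less by (meson order_le_less_trans)
  qed
qed

end
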